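(* Let $m$ be a positive integer and let $$W=(m\mathbb{N}+X_m)\cup Y^{(0)}\cup Y^{(1)},$$ where $X_m\subseteq\{0,1,\dots,m-1\}$, $Y^{(0)}\subseteq\mathbb{Z}^{-}$ and $Y^{(1)}\subseteq\mathbb{Z}$ are finite sets, $(Y^{(0)} \bmod m)\subseteq X_m$, and $(Y^{(1)} \bmod m)\cap X_m=\emptyset$. For a positive integer $T$ with $m\mid T$, put $X_T=\bigcup_{i=0}^{T/m-1}(im+X_m)$. There exists a minimal complement to $W$ if and only if there exist a positive integer $T$ with $m\mid T$ and a set $C\subseteq\{0,1,\dots,T-1\}$ such that (a) $\bigl(C+(X_T\cup Y^{(1)})\bigr) \bmod T=\{0,1,\dots,T-1\}$; (b) for any $c\in C$, there exists $y\in Y^{(1)}$ such that $c+y\not\equiv c'+x \pmod T$ for any $c'\in C\setminus\{c\}$ and $x\in X_T\cup Y^{(1)}$.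
   Context: $\mathbb{N}$ is the set of nonnegative integers, $\mathbb{Z}$ the set of integers, $\mathbb{Z}^{-}$ the set of negative integers. For $A,B\subseteq\mathbb{Z}$ and $k\in\mathbb{Z}$, $A+B=\{a+b: a\in A, b\in B\}$, $k+A=\{k+a:a\in A\}$ and $kA=\{ka:a\in A\}$. A set $A\subseteq\mathbb{Z}$ is a complement to $B\subseteq\mathbb{Z}$ (in $\mathbb{Z}$) if $A+B=\mathbb{Z}$; it is a minimal complement to $B$ if in addition no proper subset of $A$ is a complement to $B$. For a set $S$ of integers and a positive integer $n$, $S \bmod n=\{r\in\{0,1,\dots,n-1\}: r\equiv s \pmod n \text{ for some } s\in S\}$. *)

theory Defs
  imports "HOL-Library.Set_Algebras" "HOL-Number_Theory.Cong"
begin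

(* Set_Algebras provides the sumset A + B, the translate k +o A and the dilate k *o A. *)

definition complement_to :: "int set \<Rightarrow> int set \<Rightarrow> bool" where
  "complement_to A B \<longleftrightarrow> A + B = UNIV"

definition minimal_complement_to :: "int set \<Rightarrow> int set \<Rightarrow> bool" where
  "minimal_complement_to A B \<longleftrightarrow>
     complement_to A B \<and> (\<forall>A'. A' \<subset> A \<longrightarrow> \<not> complement_to A' B)"

definition residues_mod :: "int set \<Rightarrow> int \<Rightarrow> int set" where
  "residues_mod S n = {r \<in> {0..n - 1}. \<exists>s\<in>S. [r = s] (mod n)}"

(* For X = X_m and m dvd T this is X_T. *)
definition lift_residues :: "int \<Rightarrow> int set \<Rightarrow> int \<Rightarrow> int set" where
  "lift_residues m X T = (\<Union>i\<in>{0..T div m - 1}. (i * m) +o X)"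

end

theory Submission
  imports Defs
begin

text \<open>
  Write \<open>Y\<close> for \<open>Y1\<close>. Up to finitely many negative elements, \<open>W\<close> consists of the half-infinite
  progressions with residues in \<open>X\<close> and of the finite set \<open>Y\<close> of exceptional elements. The theorem
  rests on an asymmetry between the two parts. If a set \<open>A\<close> is unbounded below in the class of \<open>u\<close>
  modulo \<open>m\<close>, then an integer \<open>n\<close> with \<open>n - u\<close> in a residue class of \<open>X\<close> is automatically covered
  by \<open>A + W\<close>, infinitely often; it imposes no condition on \<open>A\<close> and can never be the reason why
  an element of \<open>A\<close> is indispensable. All the other integers have to be covered through the finite
  set \<open>Y\<close>, which is a local condition on \<open>A\<close>.

  From a cyclic solution \<open>C\<close> modulo \<open>T\<close> to a minimal complement
  (\<open>minimal_complement_if_cyclic\<close>): in the periodic set \<open>C + T\<int>\<close>, each integer that is not covered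
  through \<open>X\<close> has only finitely many representations, so Zorn's lemma (\<open>exists_minimal_cover\<close>)
  yields a subset \<open>A\<close> that is minimal among those covering all these integers. Such a
  passage to a minimal subset may fail for arbitrary complements of \<open>W\<close>, because an integer may have
  infinitely many representations. Condition (b) forces \<open>A\<close> to be unbounded below in every class of
  \<open>C\<close>, so the integers that were left out are covered for free.

  From a minimal complement \<open>A\<close> to a cyclic solution (\<open>cyclic_if_minimal_complement\<close>): far enough
  to the left, all elements of \<open>A\<close> lie in classes where \<open>A\<close> is unbounded below. Each of them is
  indispensable for some integer, which by the remark above it covers through \<open>Y\<close>. Hence both the
  covering and the indispensability are visible in a window of bounded length. By the pigeonhole
  principle (\<open>recurring_window\<close>) some window of \<open>A\<close> recurs arbitrarily far to the left; the part
  of \<open>A\<close> between two occurrences, closed up to a cycle (\<open>periodic_extension_agrees\<close>), is the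
  required \<open>C\<close>. The two occurrences are chosen so far apart that the part between them meets every
  class in which \<open>A\<close> is unbounded below, which takes care of the integers covered through \<open>X\<close>.
\<close>

section \<open>Minimal covers\<close>

text \<open>
  Zorn's lemma for the family of removable sets: if a chain of removable sets had a union that is
  not removable, then the union would contain all of the finitely many elements that cover some
  \<open>g\<close>, and so would a single member of the chain.
\<close>

lemma exists_minimal_cover:
  fixes rel :: "'a \<Rightarrow> 'b \<Rightarrow> bool"
  assumes fin: "\<And>g. g \<in> G \<Longrightarrow> finite {a \<in> A. rel a g}"
    and cov: "\<And>g. g \<in> G \<Longrightarrow> \<exists>a\<in>A. rel a g"
  shows "\<exists>B\<subseteq>A. (\<forall>g\<in>G. \<exists>a\<in>B. rel a g) \<and> (\<forall>B'. B' \<subset> B \<longrightarrow> (\<exists>g\<in>G. \<forall>a\<in>B'. \<not> rel a g))"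
proof -
  define F where "F = {S. S \<subseteq> A \<and> (\<forall>g\<in>G. \<exists>a\<in>A - S. rel a g)}"
  have "\<exists>M\<in>F. \<forall>S\<in>F. M \<subseteq> S \<longrightarrow> S = M"
  proof (rule subset_Zorn_nonempty)
    have "{} \<in> F" using cov by (auto simp: F_def)
    then show "F \<noteq> {}" by blast
  next
    fix \<C> assume ne: "\<C> \<noteq> {}" and ch: "subset.chain F \<C>"
    then have sub: "\<C> \<subseteq> F" by (simp add: subset.chain_def)
    have "\<exists>a\<in>A - \<Union>\<C>. rel a g" if g: "g \<in> G" for g
    proof (rule ccontr)
      assume "\<not> ?thesis"
      then have "{a \<in> A. rel a g} \<subseteq> \<Union>\<C>" by blast
      then obtain S where "S \<in> \<C>" "{a \<in> A. rel a g} \<subseteq> S"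
        using finite_subset_Union_chain[OF fin[OF g] _ ne ch] by blast
      moreover have "\<exists>a\<in>A - S. rel a g" using \<open>S \<in> \<C>\<close> sub g by (auto simp: F_def)
      ultimately show False by blast
    qed
    then show "\<Union>\<C> \<in> F" using sub by (auto simp: F_def)
  qed
  then obtain M where M: "M \<in> F" and max: "\<And>S. S \<in> F \<Longrightarrow> M \<subseteq> S \<Longrightarrow> S = M" by blast
  show ?thesis
  proof (intro exI[of _ "A - M"] conjI ballI allI impI)
    show "A - M \<subseteq> A" by blast
    show "\<exists>a\<in>A - M. rel a g" if "g \<in> G" for g using M that by (auto simp: F_def)
    show "\<exists>g\<in>G. \<forall>a\<in>B'. \<not> rel a g" if B': "B' \<subset> A - M" for B'
    proof (rule ccontr)
      assume *: "\<not> ?thesis"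
      have "A - (A - B') = B'" using B' by blast
      then have "A - B' \<in> F" using * by (auto simp: F_def)
      moreover have "M \<subseteq> A - B'" using B' M by (auto simp: F_def)
      ultimately have "A - B' = M" by (rule max)
      then show False using B' by blast
    qed
  qed
qed

section \<open>Recurring windows and periodic extension\<close>

text \<open>
  There are only finitely many patterns that \<open>A\<close> can show in a window of length \<open>2 * L\<close>, so one of
  them appears at infinitely many of the positions \<open>- m * l\<close>.
\<close>

lemma recurring_window:
  fixes A :: "int set" and m L :: int and K :: nat
  obtains k where "k \<ge> K"
    "\<And>D. \<exists>l\<ge>D. \<forall>j\<in>{-L..<L}. j - m * int l \<in> A \<longleftrightarrow> j - m * int k \<in> A"
proof -
  define f where "f l = {j \<in> {-L..<L}. j - m * int l \<in> A}" for l
  have "finite (f ` {K..})"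
    by (rule finite_subset[of _ "Pow {-L..<L}"]) (auto simp: f_def)
  then obtain k where k: "k \<ge> K" and inf: "infinite {l \<in> {K..}. f l = f k}"
    using pigeonhole_infinite[of "{K..}" f] infinite_Ici by auto
  show ?thesis
  proof (rule that[OF k])
    fix D
    obtain l where "l \<ge> D" "f l = f k"
      using inf by (auto simp: finite_nat_set_iff_bounded not_less)
    moreover have "\<forall>j\<in>{-L..<L}. j - m * int l \<in> A \<longleftrightarrow> j - m * int k \<in> A"
    proof
      fix j assume "j \<in> {-L..<L}"
      moreover have "j \<in> f l \<longleftrightarrow> j \<in> f k" using \<open>f l = f k\<close> by simp
      ultimately show "j - m * int l \<in> A \<longleftrightarrow> j - m * int k \<in> A" by (simp add: f_def)
    qed
    ultimately show "\<exists>l\<ge>D. \<forall>j\<in>{-L..<L}. j - m * int l \<in> A \<longleftrightarrow> j - m * int k \<in> A"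
      by blast
  qed
qed

lemma representative_in_window:
  fixes z s T :: int
  assumes "T > 0"
  obtains z' where "z' \<in> {s..<s + T}" "[z' = z] (mod T)"
proof (rule that[of "s + (z - s) mod T"])
  show "s + (z - s) mod T \<in> {s..<s + T}" using assms by simp
  show "[s + (z - s) mod T = z] (mod T)" by (simp add: cong_def mod_simps)
qed

lemma cong_in_window_eq:
  fixes a b s T :: int
  assumes "a \<in> {s..<s + T}" "b \<in> {s..<s + T}" "[a = b] (mod T)"
  shows "a = b"
proof -
  have "[a - s = b - s] (mod T)" using assms(3) by (intro cong_diff) auto
  then have "a - s = b - s" using assms(1,2) by (intro cong_less_imp_eq_int[of "a-s" T "b-s"]) auto
  then show ?thesis by simp
qed

text \<open>
  The \<open>T\<close>-periodic set generated by \<open>A \<inter> {s..<s + T}\<close> coincides with \<open>A\<close> not only on that interval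
  but also on margins of width \<open>L\<close>: \<open>A\<close> looks the same around \<open>s\<close> and around \<open>s + T\<close>, so leaving the
  interval at one end amounts to re-entering it at the other. Conditions that involve only elements
  at distance less than \<open>L\<close> therefore pass from \<open>A\<close> to the periodic set.
\<close>

lemma periodic_extension_agrees:
  fixes A :: "int set" and s T L :: int
  assumes "T > 0" "L \<le> T"
    and agree: "\<And>z. z \<in> {s - L..<s + L} \<Longrightarrow> z \<in> A \<longleftrightarrow> z + T \<in> A"
    and z: "z \<in> {s - L..<s + T + L}"
  shows "z mod T \<in> (\<lambda>a. a mod T) ` (A \<inter> {s..<s + T}) \<longleftrightarrow> z \<in> A"
proof -
  have key: "z mod T \<in> (\<lambda>a. a mod T) ` (A \<inter> {s..<s + T}) \<longleftrightarrow> z' \<in> A"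
    if z': "z' \<in> {s..<s + T}" "[z' = z] (mod T)" for z'
  proof
    assume "z mod T \<in> (\<lambda>a. a mod T) ` (A \<inter> {s..<s + T})"
    then obtain a where a: "a \<in> A" "a \<in> {s..<s + T}" "z mod T = a mod T" by blast
    then have "[z' = a] (mod T)" using z'(2) by (simp add: cong_def)
    then show "z' \<in> A" using a z' cong_in_window_eq by blast
  next
    assume "z' \<in> A"
    then show "z mod T \<in> (\<lambda>a. a mod T) ` (A \<inter> {s..<s + T})"
      using z' by (intro image_eqI[of _ _ z']) (auto simp: cong_def)
  qed
  consider "z < s" | "z \<in> {s..<s + T}" | "z \<ge> s + T" by fastforce
  then show ?thesis
  proof cases
    case 1
    then show ?thesis using key[of "z + T"] agree[of z] z assms(1,2) by (auto simp: cong_def)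
  next
    case 2
    then show ?thesis using key[of z] by auto
  next
    case 3
    then show ?thesis using key[of "z - T"] agree[of "z - T"] z assms(1,2)
      by (auto simp: cong_def mod_simps)
  qed
qed

section \<open>Sets that are eventually periodic to the right\<close>

lemma lift_residues_eq:
  assumes "m > 0" "T > 0" "m dvd T" "X \<subseteq> {0..m - 1}"
  shows "lift_residues m X T = {x \<in> {0..T - 1}. x mod m \<in> X}"
proof (intro set_eqI iffI)
  fix v assume "v \<in> lift_residues m X T"
  then obtain i x where i: "0 \<le> i" "i \<le> T div m - 1" and x: "x \<in> X" and v: "v = i * m + x"
    by (auto simp: lift_residues_def elt_set_plus_def)
  have x': "0 \<le> x" "x < m" using x assms(4) by force+
  have "(i + 1) * m \<le> (T div m) * m" using i assms(1) by (intro mult_right_mono) auto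
  also have "\<dots> = T" using assms(3) by simp
  finally have "v \<le> T - 1" using x' v by (simp add: algebra_simps)
  then show "v \<in> {x \<in> {0..T - 1}. x mod m \<in> X}" using x x' v i assms(1) by simp
next
  fix v assume v: "v \<in> {x \<in> {0..T - 1}. x mod m \<in> X}"
  have "v div m \<ge> 0" using v assms(1) by (simp add: pos_imp_zdiv_nonneg_iff)
  moreover have "v div m * m < T div m * m"
  proof -
    have "v div m * m \<le> v" using div_mult_mod_eq[of v m] assms(1)
      by (smt (verit) pos_mod_sign)
    then show ?thesis using v assms(3) by simp
  qed
  then have "v div m \<le> T div m - 1" using assms(1) by simp
  moreover have "v = v div m * m + v mod m" by simp
  ultimately show "v \<in> lift_residues m X T" using v
    unfolding lift_residues_def elt_set_plus_def by fastforce
qed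

text \<open>
  The shape of \<open>W\<close> that the proof depends on. The negative elements with residues in \<open>X\<close> are kept
  anonymous: all that matters about them is their residue and that \<open>W\<close> stays bounded below.
\<close>

locale eventually_periodic =
  fixes m :: int and X Y W :: "int set"
  assumes m_pos: "m > 0"
    and X_residues: "X \<subseteq> {0..m - 1}"
    and finite_Y: "finite Y"
    and Y_mod: "y \<in> Y \<Longrightarrow> y mod m \<notin> X"
    and Y_sub: "Y \<subseteq> W"
    and W_cases: "w \<in> W \<Longrightarrow> w mod m \<in> X \<or> w \<in> Y"
    and W_nonneg: "w \<ge> 0 \<Longrightarrow> w mod m \<in> X \<Longrightarrow> w \<in> W"
    and W_bdd_below: "bdd_below W"
begin

text \<open>The set that replaces \<open>W\<close> when integers are only considered modulo \<open>T\<close>.\<close>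

definition cyclic_form :: "int \<Rightarrow> int set" where
  "cyclic_form T = lift_residues m X T \<union> Y"

lemma cong_cyclic_form_iff:
  assumes "T > 0" "m dvd T"
  shows "(\<exists>x\<in>cyclic_form T. [v = x] (mod T)) \<longleftrightarrow> v mod m \<in> X \<or> (\<exists>y\<in>Y. [v = y] (mod T))"
proof -
  have eq: "lift_residues m X T = {x \<in> {0..T - 1}. x mod m \<in> X}"
    using lift_residues_eq m_pos X_residues assms by blast
  have "v mod m \<in> X" if "x \<in> lift_residues m X T" "[v = x] (mod T)" for x
    using that eq cong_dvd_modulus[OF that(2) assms(2)] by (simp add: cong_def)
  moreover have "\<exists>x\<in>lift_residues m X T. [v = x] (mod T)" if "v mod m \<in> X"
    using that eq assms by (intro bexI[of _ "v mod T"]) (auto simp: cong_def mod_mod_cancel)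
  ultimately show ?thesis by (auto simp: cyclic_form_def)
qed

section \<open>From a cyclic solution to a minimal complement\<close>

text \<open>
  The periodic set \<open>P = C + T\<int>\<close> is thinned out to a minimal \<open>A\<close> that still covers the set \<open>G\<close> of
  integers out of reach of \<open>X\<close>. For \<open>c \<in> C\<close>, the private target \<open>c + y\<close> of condition (b) and all
  its translates by multiples of \<open>T\<close> belong to \<open>G\<close> and can only be covered from the class of \<open>c\<close>;
  as \<open>Y\<close> is finite, this keeps \<open>A\<close> unbounded below in that class.
\<close>

lemma minimal_complement_if_cyclic:
  assumes T: "T > 0" "m dvd T"
    and cover: "\<And>n. \<exists>c\<in>C. \<exists>x\<in>cyclic_form T. [n = c + x] (mod T)"
    and own_target: "\<And>c. c \<in> C \<Longrightarrow> \<exists>y\<in>Y. \<forall>c'\<in>C - {c}. \<forall>x\<in>cyclic_form T. \<not> [c + y = c' + x] (mod T)"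
  shows "\<exists>A. minimal_complement_to A W"
proof -
  define P where "P = {a. \<exists>c\<in>C. [a = c] (mod T)}"
  define G where "G = {n. \<forall>c\<in>C. (n - c) mod m \<notin> X}"
  have P_diff: "(n - a) mod m = (n - c) mod m" if "[a = c] (mod T)" for a c n :: int
    using cong_diff[OF cong_refl cong_dvd_modulus[OF that T(2)]] by (simp add: cong_def)
  have P_diff_G: "(n - a) mod m \<notin> X" if "n \<in> G" "a \<in> P" for n a
    using that P_diff by (auto simp: G_def P_def)
  have fin: "finite {a \<in> P. g - a \<in> Y}" for g
    by (rule finite_subset[of _ "(\<lambda>y. g - y) ` Y"]) (force simp: finite_Y)+
  have cov: "\<exists>a\<in>P. g - a \<in> Y" if g: "g \<in> G" for g
  proof -
    obtain c x where c: "c \<in> C" and "x \<in> cyclic_form T" "[g = c + x] (mod T)" using cover by blast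
    then have "\<exists>x\<in>cyclic_form T. [g - c = x] (mod T)" by (auto simp: cong_iff_dvd_diff algebra_simps)
    then obtain y where "y \<in> Y" "[g - c = y] (mod T)"
      using g c cong_cyclic_form_iff[OF T] by (auto simp: G_def)
    then show ?thesis using c
      by (intro bexI[of _ "g - y"]) (auto simp: P_def cong_iff_dvd_diff algebra_simps)
  qed
  have "\<exists>A\<subseteq>P. (\<forall>g\<in>G. \<exists>a\<in>A. g - a \<in> Y) \<and>
      (\<forall>B. B \<subset> A \<longrightarrow> (\<exists>g\<in>G. \<forall>a\<in>B. g - a \<notin> Y))"
    by (rule exists_minimal_cover[of G P "\<lambda>a g. g - a \<in> Y", OF fin cov])
  then obtain A where A: "A \<subseteq> P" "\<forall>g\<in>G. \<exists>a\<in>A. g - a \<in> Y"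
    "\<forall>B. B \<subset> A \<longrightarrow> (\<exists>g\<in>G. \<forall>a\<in>B. g - a \<notin> Y)"
    by (elim exE conjE)
  have unbounded: "\<exists>a\<in>A. [a = c] (mod T) \<and> a \<le> N" if c: "c \<in> C" for c N
  proof -
    obtain y where y: "y \<in> Y"
      and pr: "\<And>c' x. c' \<in> C - {c} \<Longrightarrow> x \<in> cyclic_form T \<Longrightarrow> \<not> [c + y = c' + x] (mod T)"
      using own_target[OF c] by blast
    have no: "\<not> (\<exists>x\<in>cyclic_form T. [c + y - c' = x] (mod T))" if "c' \<in> C - {c}" for c'
      using pr[OF that] by (auto simp: cong_iff_dvd_diff algebra_simps)
    have cyG: "(c + y - c') mod m \<notin> X" if "c' \<in> C" for c'
      using no[of c'] that cong_cyclic_form_iff[OF T] Y_mod[OF y] by (cases "c' = c") auto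
    obtain b where b: "\<And>w. w \<in> Y \<Longrightarrow> b \<le> w" using finite_Y
      by (metis bdd_below_finite bdd_below_def)
    \<comment> \<open>The translate \<open>g\<close> of the private target lies so far to the left that every element covering
      it through \<open>Y\<close> is at most \<open>N\<close>.\<close>
    define q where "q = \<bar>N\<bar> + \<bar>b\<bar> + \<bar>c + y\<bar>"
    define g where "g = c + y - q * T"
    have g_cong: "[g = c + y] (mod T)" by (simp add: g_def cong_iff_dvd_diff)
    have "g \<in> G" unfolding G_def
    proof (intro CollectI ballI)
      fix c' assume "c' \<in> C"
      moreover have "(g - c') mod m = (c + y - c') mod m"
        using cong_diff[OF cong_dvd_modulus[OF g_cong T(2)] cong_refl] by (simp add: cong_def)
      ultimately show "(g - c') mod m \<notin> X" using cyG by simp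
    qed
    then obtain a where a: "a \<in> A" "g - a \<in> Y" using A(2) by blast
    have "q * 1 \<le> q * T" using T(1) by (intro mult_left_mono) (auto simp: q_def)
    moreover have "b \<le> c + y - q * T - a" using b[OF a(2)] by (simp add: g_def)
    moreover have "c + y - b - N \<le> q" unfolding q_def by linarith
    ultimately have "a \<le> N" by linarith
    moreover obtain c' where c': "c' \<in> C" "[a = c'] (mod T)" using A(1) a(1) by (auto simp: P_def)
    have "c' = c"
    proof (rule ccontr)
      assume "c' \<noteq> c"
      have "[c + y - c' = g - a] (mod T)" using g_cong c'(2)
        by (intro cong_diff) (auto simp: cong_sym)
      then show False using no[of c'] c'(1) \<open>c' \<noteq> c\<close> a(2) by (auto simp: cyclic_form_def)
    qed
    ultimately show ?thesis using a(1) c' by blast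
  qed
  have "n \<in> A + W" for n
  proof (cases "n \<in> G")
    case True
    then obtain a where a: "a \<in> A" "n - a \<in> Y" using A(2) by blast
    then show ?thesis using set_plus_intro[of a A "n - a" W] Y_sub by auto
  next
    case False
    then obtain c where c: "c \<in> C" "(n - c) mod m \<in> X" by (auto simp: G_def)
    then obtain a where a: "a \<in> A" "[a = c] (mod T)" "a \<le> n" using unbounded by blast
    then have "n - a \<in> W" using c P_diff by (intro W_nonneg) auto
    then show ?thesis using set_plus_intro[of a A "n - a" W] a by auto
  qed
  moreover have "B + W \<noteq> UNIV" if B: "B \<subset> A" for B
  proof
    assume "B + W = UNIV"
    have "\<exists>g\<in>G. \<forall>a\<in>B. g - a \<notin> Y" using A(3) B by simp
    then obtain g where g: "g \<in> G" "\<forall>a\<in>B. g - a \<notin> Y" by (elim bexE)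
    have "g \<in> B + W" using \<open>B + W = UNIV\<close> by simp
    then obtain a w where aw: "a \<in> B" "w \<in> W" "g = a + w" by (auto elim: set_plus_elim)
    then have "(g - a) mod m \<notin> X" using P_diff_G g(1) B A(1) by blast
    then show False using W_cases[of w] g(2) aw by auto
  qed
  ultimately show ?thesis unfolding minimal_complement_to_def complement_to_def by blast
qed

section \<open>From a minimal complement to a cyclic solution\<close>

text \<open>
  \<open>U\<close> is the union of the residue classes modulo \<open>m\<close> in which \<open>A\<close> is unbounded below. Left of a
  certain point, \<open>A\<close> is contained in \<open>U\<close>, and there each element of \<open>A\<close> has a target \<open>a + y\<close> of its
  own with \<open>y \<in> Y\<close>. The cyclic solution is cut out of this region between two occurrences, around
  \<open>s\<close> and \<open>e = s + T\<close>, of the same window of \<open>A\<close>.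
\<close>

lemma cyclic_if_minimal_complement:
  assumes min: "minimal_complement_to A W"
  shows "\<exists>T C. T > 0 \<and> m dvd T \<and> C \<subseteq> {0..T - 1} \<and>
    (\<forall>n. \<exists>c\<in>C. \<exists>x\<in>cyclic_form T. [n = c + x] (mod T)) \<and>
    (\<forall>c\<in>C. \<exists>y\<in>Y. \<forall>c'\<in>C - {c}. \<forall>x\<in>cyclic_form T. \<not> [c + y = c' + x] (mod T))"
proof -
  define U where "U = {u. \<forall>N. \<exists>a\<in>A. [a = u] (mod m) \<and> a < N}"
  have U_below: "\<exists>a\<in>A. [a = u] (mod m) \<and> a < N" if "u \<in> U" for u N
    using that by (simp add: U_def)
  have U_cong: "v \<in> U" if u: "u \<in> U" and uv: "[u = v] (mod m)" for u v
  proof -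
    have "\<exists>a\<in>A. [a = v] (mod m) \<and> a < N" for N
    proof -
      obtain a where "a \<in> A" "[a = u] (mod m)" "a < N" using U_below[OF u] by blast
      then show ?thesis using cong_trans[OF _ uv] by blast
    qed
    then show ?thesis by (simp add: U_def)
  qed
  obtain M where M: "\<And>a. a \<in> A \<Longrightarrow> a < M \<Longrightarrow> a \<in> U"
  proof -
    have "\<exists>N. \<forall>a\<in>A. [a = r] (mod m) \<longrightarrow> a \<in> U \<or> a \<ge> N" for r
    proof (cases "r \<in> U")
      case True
      then show ?thesis using U_cong cong_sym by blast
    next
      case False
      then obtain N where "\<not> (\<exists>a\<in>A. [a = r] (mod m) \<and> a < N)" by (auto simp only: U_def mem_Collect_eq)
      then show ?thesis by (meson not_less)
    qed
    then obtain N where N: "\<And>r a. a \<in> A \<Longrightarrow> [a = r] (mod m) \<Longrightarrow> a \<in> U \<or> a \<ge> N r" by metis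
    have "bdd_below (N ` {0..<m})" by simp
    then obtain M where M: "\<forall>r\<in>{0..<m}. M \<le> N r" unfolding bdd_below_def by blast
    have "a \<in> U" if "a \<in> A" "a < M" for a
    proof -
      have "M \<le> N (a mod m)" using M m_pos by simp
      then show ?thesis using N[OF that(1), of "a mod m"] that(2) by (simp add: cong_def)
    qed
    then show ?thesis by (rule that)
  qed
  \<comment> \<open>An integer within reach of \<open>X\<close> from \<open>U\<close> is covered infinitely often, hence also without
    the use of any given \<open>a\<close>.\<close>
  have not_own_target: "\<exists>a'\<in>A - {a}. n - a' \<in> W" if "u \<in> U" "(n - u) mod m \<in> X" for a u n
  proof -
    obtain a' where a': "a' \<in> A" "[a' = u] (mod m)" "a' < min a n"
      using U_below[OF \<open>u \<in> U\<close>] by blast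
    have "(n - a') mod m = (n - u) mod m"
      using cong_diff[OF cong_refl a'(2)] by (simp add: cong_def)
    then have "n - a' \<in> W" using that a' by (intro W_nonneg) auto
    then show ?thesis using a' by auto
  qed
  have covers: "\<exists>a\<in>A. n - a \<in> W" for n
  proof -
    have "n \<in> A + W" using min by (simp add: minimal_complement_to_def complement_to_def)
    then obtain a w where "n = a + w" "a \<in> A" "w \<in> W" by (rule set_plus_elim)
    then show ?thesis by (intro bexI[of _ a]) simp_all
  qed
  have own_target: "\<exists>y\<in>Y. (\<forall>a'\<in>A - {a}. a + y - a' \<notin> W) \<and> (\<forall>u\<in>U. (a + y - u) mod m \<notin> X)"
    if a: "a \<in> A" "a \<in> U" for a
  proof -
    have "A - {a} \<subset> A" using a by blast
    then have "(A - {a}) + W \<noteq> UNIV"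
      using min by (simp add: minimal_complement_to_def complement_to_def)
    then obtain n where "n \<notin> (A - {a}) + W" by blast
    then have n: "\<forall>a'\<in>A - {a}. n - a' \<notin> W"
      by (metis add.commute diff_add_cancel set_plus_intro)
    then have nU: "\<forall>u\<in>U. (n - u) mod m \<notin> X" using not_own_target by blast
    have "n - a \<in> W" using covers[of n] n by blast
    then have "n - a \<in> Y" using W_cases nU a(2) by blast
    then show ?thesis using n nU by (intro bexI[of _ "n - a"]) auto
  qed
  obtain b where b: "\<And>w. w \<in> W \<Longrightarrow> b \<le> w" using W_bdd_below by (auto simp: bdd_below_def)
  obtain B where B: "\<And>y. y \<in> Y \<Longrightarrow> \<bar>y\<bar> \<le> B" "B \<ge> 0"
  proof -
    have "bdd_above (abs ` Y)" using finite_Y by simp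
    then obtain B where "\<And>y. y \<in> Y \<Longrightarrow> \<bar>y\<bar> \<le> B" by (auto simp: bdd_above_def)
    then show ?thesis by (intro that[of "max B 0"]) force+
  qed
  \<comment> \<open>If \<open>a + y = a'' + y'\<close> with \<open>y, y' \<in> Y\<close>, then \<open>a\<close> and \<open>a''\<close> are at most \<open>2 * B\<close> apart.\<close>
  define L where "L = 2 * B + 1"
  \<comment> \<open>The right end \<open>e\<close> satisfies \<open>e - b \<le> M\<close>, where \<open>b\<close> bounds \<open>W\<close> from below: whatever covers an
    integer left of \<open>e\<close> then belongs to \<open>U\<close>.\<close>
  obtain k where k: "k \<ge> nat (\<bar>M\<bar> + \<bar>b\<bar>)"
    and recur: "\<And>D. \<exists>l\<ge>D. \<forall>j\<in>{-L..<L}. j - m * int l \<in> A \<longleftrightarrow> j - m * int k \<in> A"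
    using recurring_window[of _ L m A] by blast
  define e where "e = - m * int k"
  have "1 * int k \<le> m * int k" using m_pos by (intro mult_right_mono) auto
  then have e: "e \<le> - \<bar>M\<bar> - \<bar>b\<bar>" using k by (simp add: e_def)
  have far: "a \<in> U" if "a \<in> A" "a < e - b" for a using M[OF that(1)] that(2) e by linarith
  have far': "a \<in> U" if "a \<in> A" "a < e" for a using M[OF that(1)] that(2) e by linarith
  \<comment> \<open>The left end \<open>s\<close> will be at most \<open>N\<close>, so that the piece cut out meets every class of \<open>U\<close>.\<close>
  obtain N where N: "\<And>u. u \<in> U \<Longrightarrow> \<exists>a\<in>A. [a = u] (mod m) \<and> N \<le> a \<and> a < e"
  proof -
    have "\<exists>a\<in>A. [a = u] (mod m) \<and> a < e" if "u \<in> U" for u using U_below[OF that] .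
    then obtain h where h: "\<And>u. u \<in> U \<Longrightarrow> h u \<in> A \<and> [h u = u] (mod m) \<and> h u < e" by metis
    have "bdd_below (h ` (U \<inter> {0..<m}))" by simp
    then obtain N where N: "\<And>u. u \<in> U \<inter> {0..<m} \<Longrightarrow> N \<le> h u" unfolding bdd_below_def by blast
    show ?thesis
    proof (rule that[of N])
      fix u assume "u \<in> U"
      then have u: "u mod m \<in> U" using U_cong[of u "u mod m"] by (simp add: cong_def)
      then show "\<exists>a\<in>A. [a = u] (mod m) \<and> N \<le> a \<and> a < e"
        using h[OF u] N[of "u mod m"] m_pos by (intro bexI[of _ "h (u mod m)"]) (auto simp: cong_def)
    qed
  qed
  obtain l where l: "l \<ge> nat \<bar>N\<bar> + k + nat L"
    and agree: "\<forall>j\<in>{-L..<L}. j - m * int l \<in> A \<longleftrightarrow> j - m * int k \<in> A" using recur by blast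
  have l_int: "\<bar>N\<bar> + int k + L \<le> int l"
  proof -
    have "int (nat \<bar>N\<bar> + k + nat L) \<le> int l" using l by (simp only: of_nat_le_iff)
    then show ?thesis by (simp split: if_splits)
  qed
  define s where "s = - m * int l"
  define T where "T = m * (int l - int k)"
  have sT: "s + T = e" by (simp add: s_def T_def e_def algebra_simps)
  have "1 * (int l - int k) \<le> T" unfolding T_def using m_pos l by (intro mult_right_mono) auto
  then have TL: "L \<le> T" using l_int by simp
  have T_pos: "T > 0" using TL B(2) by (simp add: L_def)
  have T_dvd: "m dvd T" by (simp add: T_def)
  have "1 * int l \<le> m * int l" using m_pos by (intro mult_right_mono) auto
  then have sN: "s \<le> N" using l_int B(2) unfolding s_def L_def by linarith
  define C where "C = (\<lambda>a. a mod T) ` (A \<inter> {s..<s + T})"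
  have ext: "z mod T \<in> C \<longleftrightarrow> z \<in> A" if "z \<in> {s - L..<s + T + L}" for z
    unfolding C_def
  proof (rule periodic_extension_agrees[OF T_pos TL _ that])
    fix z assume "z \<in> {s - L..<s + L}"
    then show "z \<in> A \<longleftrightarrow> z + T \<in> A"
      using agree[rule_format, of "z - s"] by (auto simp: s_def T_def algebra_simps)
  qed
  have coveredI: "\<exists>c\<in>C. \<exists>x\<in>cyclic_form T. [n = c + x] (mod T)"
    if a: "a mod T \<in> C" and n: "(n - a) mod m \<in> X \<or> (\<exists>y\<in>Y. [n - a = y] (mod T))" for n a
  proof -
    obtain x where "x \<in> cyclic_form T" "[n - a = x] (mod T)"
      using n cong_cyclic_form_iff[OF T_pos T_dvd] by blast
    moreover have "[n = a mod T + x] (mod T)"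
      using cong_add[OF \<open>[n - a = x] (mod T)\<close> cong_refl[of a]]
      by (simp add: cong_def mod_simps add.commute)
    ultimately show ?thesis using a by blast
  qed
  show ?thesis
  proof (rule exI[of _ T], rule exI[of _ C], intro conjI allI ballI)
    show "T > 0" "m dvd T" by (fact T_pos T_dvd)+
    show "C \<subseteq> {0..T - 1}" using T_pos by (auto simp: C_def)
  next
    fix n0
    obtain n where n: "n \<in> {s..<s + T}" "[n = n0] (mod T)"
      using representative_in_window[OF T_pos] .
    obtain a where a: "a \<in> A" "n - a \<in> W" using covers by blast
    have aU: "a \<in> U" using far[OF a(1)] b[OF a(2)] n(1) sT by auto
    have "\<exists>c\<in>C. \<exists>x\<in>cyclic_form T. [n = c + x] (mod T)"
    proof (cases "n - a \<in> Y")
      case True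
      then have "a \<in> {s - L..<s + T + L}" using B(1)[OF True] B(2) n(1) by (auto simp: L_def)
      then have "a mod T \<in> C" using ext a(1) by blast
      then show ?thesis using coveredI True cong_refl by blast
    next
      case False
      then have X: "(n - a) mod m \<in> X" using W_cases a(2) by blast
      obtain a' where a': "a' \<in> A" "[a' = a] (mod m)" "N \<le> a'" "a' < e" using N[OF aU] by blast
      then have "a' mod T \<in> C" using sN sT by (auto simp: C_def)
      moreover have "(n - a') mod m = (n - a) mod m"
        using cong_diff[OF cong_refl a'(2)] by (simp add: cong_def)
      ultimately show ?thesis using coveredI X by metis
    qed
    then show "\<exists>c\<in>C. \<exists>x\<in>cyclic_form T. [n0 = c + x] (mod T)" using n(2) by (meson cong_sym cong_trans)
  next
    fix c assume "c \<in> C"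
    then obtain a where a: "a \<in> A" "a \<in> {s..<s + T}" "c = a mod T" by (auto simp: C_def)
    have "a \<in> U" using far' a sT by auto
    then obtain y where y: "y \<in> Y" and py: "\<And>a'. a' \<in> A - {a} \<Longrightarrow> a + y - a' \<notin> W"
      and pU: "\<And>u. u \<in> U \<Longrightarrow> (a + y - u) mod m \<notin> X" using own_target[OF a(1)] by blast
    have no_collision: "\<not> [c + y = c' + x] (mod T)" if c': "c' \<in> C - {c}" and x: "x \<in> cyclic_form T" for c' x
    proof
      assume "[c + y = c' + x] (mod T)"
      obtain a' where a': "a' \<in> A" "a' \<in> {s..<s + T}" "c' = a' mod T" using c' by (auto simp: C_def)
      have "[a + y = a' + x] (mod T)" using \<open>[c + y = c' + x] (mod T)\<close> a(3) a'(3)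
        by (simp add: cong_def mod_simps)
      then have cong: "[a + y - a' = x] (mod T)" by (auto simp: cong_iff_dvd_diff algebra_simps)
      have "a' \<in> U" using far' a' sT by auto
      then obtain y' where y': "y' \<in> Y" "[a + y - a' = y'] (mod T)"
        using cong_cyclic_form_iff[OF T_pos T_dvd, of "a + y - a'"] cong x pU by blast
      \<comment> \<open>The element congruent to \<open>a'\<close> that collides with \<open>a\<close> in the integers; it lies within the
        margins, so it is a genuine element of \<open>A\<close>.\<close>
      define a'' where "a'' = a + y - y'"
      have a''_cong: "[a'' = a'] (mod T)" using y'(2)
        by (auto simp: a''_def cong_iff_dvd_diff algebra_simps)
      then have "a'' mod T \<in> C" using c' a'(3) by (simp add: cong_def)
      moreover have "a'' \<in> {s - L..<s + T + L}"
        using B(1)[OF y] B(1)[OF y'(1)] a(2) by (auto simp: a''_def L_def)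
      ultimately have "a'' \<in> A" using ext by blast
      moreover have "a'' \<noteq> a" using c' a''_cong a(3) a'(3) by (auto simp: cong_def)
      ultimately have "a + y - a'' \<notin> W" using py by blast
      then show False using y'(1) Y_sub by (auto simp: a''_def)
    qed
    show "\<exists>y\<in>Y. \<forall>c'\<in>C - {c}. \<forall>x\<in>cyclic_form T. \<not> [c + y = c' + x] (mod T)"
      by (rule bexI[OF _ y], rule ballI, rule ballI, rule no_collision)
  qed
qed

end

section \<open>The characterisation\<close>

lemma residues_mod_full_iff:
  assumes "T > 0"
  shows "residues_mod (C + S) T = {0..T - 1} \<longleftrightarrow> (\<forall>n. \<exists>c\<in>C. \<exists>x\<in>S. [n = c + x] (mod T))"
proof
  assume full: "residues_mod (C + S) T = {0..T - 1}"
  show "\<forall>n. \<exists>c\<in>C. \<exists>x\<in>S. [n = c + x] (mod T)"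
  proof
    fix n
    have "n mod T \<in> residues_mod (C + S) T" using full assms by simp
    then show "\<exists>c\<in>C. \<exists>x\<in>S. [n = c + x] (mod T)"
      by (auto simp: residues_mod_def elim!: set_plus_elim)
  qed
next
  assume "\<forall>n. \<exists>c\<in>C. \<exists>x\<in>S. [n = c + x] (mod T)"
  then have "\<exists>s\<in>C + S. [n = s] (mod T)" for n by (meson set_plus_intro)
  then show "residues_mod (C + S) T = {0..T - 1}" by (auto simp: residues_mod_def)
qed

lemma residues_mod_iff:
  assumes "n > 0"
  shows "r \<in> residues_mod S n \<longleftrightarrow> (\<exists>s\<in>S. r = s mod n)"
  using assms by (auto simp: residues_mod_def cong_def)

lemma eventually_periodicI:
  fixes m :: int and X Y0 Y1 W :: "int set"
  assumes "m > 0" "X \<subseteq> {0..m - 1}" "finite Y0" "finite Y1"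
    and "residues_mod Y0 m \<subseteq> X" "residues_mod Y1 m \<inter> X = {}"
    and W: "W = (m *o \<nat> + X) \<union> Y0 \<union> Y1"
  shows "eventually_periodic m X Y1 W"
proof
  have prog: "w \<in> m *o \<nat> + X \<longleftrightarrow> w \<ge> 0 \<and> w mod m \<in> X" for w
  proof
    assume "w \<in> m *o \<nat> + X"
    then obtain k x where kx: "x \<in> X" "w = m * int k + x"
      by (auto simp: elt_set_times_def elim!: set_plus_elim Nats_cases)
    moreover have "0 \<le> x" "x < m" using kx assms(2) by force+
    ultimately show "w \<ge> 0 \<and> w mod m \<in> X" using assms(1) by simp
  next
    assume w: "w \<ge> 0 \<and> w mod m \<in> X"
    then have "w div m \<in> \<nat>" using assms(1)
      by (metis of_nat_in_Nats nonneg_int_cases pos_imp_zdiv_nonneg_iff)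
    then have "m * (w div m) \<in> m *o \<nat>" by (auto simp: elt_set_times_def)
    then have "m * (w div m) + w mod m \<in> m *o \<nat> + X" using w by (intro set_plus_intro) auto
    then show "w \<in> m *o \<nat> + X" by simp
  qed
  show "m > 0" "X \<subseteq> {0..m - 1}" "finite Y1" "Y1 \<subseteq> W" using assms by auto
  show "y mod m \<notin> X" if "y \<in> Y1" for y
    using that assms residues_mod_iff by (metis disjoint_iff)
  have Y0: "y mod m \<in> X" if "y \<in> Y0" for y
    using that assms residues_mod_iff by (metis subsetD)
  show "w mod m \<in> X \<or> w \<in> Y1" if "w \<in> W" for w using that prog Y0 W by auto
  show "w \<in> W" if "w \<ge> 0" "w mod m \<in> X" for w using that prog W by auto
  have "bdd_below (m *o \<nat> + X)" using prog by (intro bdd_belowI[of _ 0]) auto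
  then show "bdd_below W" using assms(3,4) by (simp add: W)
qed

theorem theorem3:
  fixes m :: int and X Y0 Y1 W :: "int set"
  assumes "m > 0"
    and "X \<subseteq> {0..m - 1}"
    and "finite Y0" and "Y0 \<subseteq> {..<0}"
    and "finite Y1"
    and "residues_mod Y0 m \<subseteq> X"
    and "residues_mod Y1 m \<inter> X = {}"
    and "W = (m *o \<nat> + X) \<union> Y0 \<union> Y1"
  shows "(\<exists>A. minimal_complement_to A W) \<longleftrightarrow>
    (\<exists>T C. T > 0 \<and> m dvd T \<and> C \<subseteq> {0..T - 1} \<and>
       residues_mod (C + (lift_residues m X T \<union> Y1)) T = {0..T - 1} \<and>
       (\<forall>c\<in>C. \<exists>y\<in>Y1. \<forall>c'\<in>C - {c}. \<forall>x\<in>lift_residues m X T \<union> Y1.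
          \<not> [c + y = c' + x] (mod T)))"
proof -
  interpret eventually_periodic m X Y1 W
    using assms by (intro eventually_periodicI)
  show ?thesis
  proof
    assume "\<exists>A. minimal_complement_to A W"
    then obtain A where A: "minimal_complement_to A W" ..
    show "\<exists>T C. T > 0 \<and> m dvd T \<and> C \<subseteq> {0..T - 1} \<and>
       residues_mod (C + (lift_residues m X T \<union> Y1)) T = {0..T - 1} \<and>
       (\<forall>c\<in>C. \<exists>y\<in>Y1. \<forall>c'\<in>C - {c}. \<forall>x\<in>lift_residues m X T \<union> Y1.
          \<not> [c + y = c' + x] (mod T))"
      using cyclic_if_minimal_complement[OF A] unfolding cyclic_form_def
      by (simp add: residues_mod_full_iff cong: conj_cong)
  next
    assume "\<exists>T C. T > 0 \<and> m dvd T \<and> C \<subseteq> {0..T - 1} \<and>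
       residues_mod (C + (lift_residues m X T \<union> Y1)) T = {0..T - 1} \<and>
       (\<forall>c\<in>C. \<exists>y\<in>Y1. \<forall>c'\<in>C - {c}. \<forall>x\<in>lift_residues m X T \<union> Y1.
          \<not> [c + y = c' + x] (mod T))"
    then obtain T C where "T > 0" "m dvd T"
      "residues_mod (C + cyclic_form T) T = {0..T - 1}"
      "\<forall>c\<in>C. \<exists>y\<in>Y1. \<forall>c'\<in>C - {c}. \<forall>x\<in>cyclic_form T. \<not> [c + y = c' + x] (mod T)"
      unfolding cyclic_form_def by blast
    then show "\<exists>A. minimal_complement_to A W"
      by (intro minimal_complement_if_cyclic[of T C]) (simp_all add: residues_mod_full_iff)
  qed
qed

end
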